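(* There is a constant $M$ depending only on $d_y,d_r,\underline d$ (and not on $m$, $T$, the sets $\Omega_t$ or $\Psi$) such that the following holds. Suppose the step sizes are $\eta_t=\min\{\frac1m,\frac1{\sqrt{mt}}\}$ for all $t=1,\dots,T$. Then, for every sequence of local feasible sets $(\Omega_t)_{t=1}^T$ satisfying the standing assumptions, the decisions $(r_t,x_t,y_t)_{t=1}^T$ produced by the primal-dual algorithm satisfy $$\mathrm{dist}\Big(\sum_{t=1}^T y_t,\;T\Psi\Big)\le M\sqrt{mT},$$ i.e. the fairness violation is $O(\sqrt{mT})$ deterministically.
   Context: Setting. $T,m\ge 1$ are integers. For $t=1,\dots,T$, $\Omega_t\subseteq\mathbb R\times\mathbb R^{n_t}\times\mathbb R^m$ is a nonempty compact (possibly non-convex) set of decisions $(r,x,y)$: $r$ is the reward, $x$ an auxiliary variable, $y\in\mathbb R^m$ the fairness impact. $\Psi\subseteq\mathbb R^m$ is a closed convex set that is Motzkin decomposable: $\Psi=Q+C$ with $Q$ a nonempty compact convex set and $C$ a closed convex cone (the recession cone of $\Psi$). $C^\circ=\{p\in\mathbb R^m: p^\top c\le 0\ \forall c\in C\}$ is the polar cone of $C$, and $\mathrm{proj}_{C^\circ}$ is Euclidean projection. $\mathrm{dist}$ is Euclidean distance to a closed set and $T\Psi=\{Tv:v\in\Psi\}$. The convexified problem $\max\{\sum_{t=1}^T r_t:(r_t,x_t,y_t)\in\mathrm{conv}(\Omega_t)\ \forall t,\ \sum_{t=1}^T y_t\in T\Psi\}$ is assumed feasible. Regularity assumptions. There are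 constants $d_y,d_r,\underline d>0$ with $d_y=O(1)$, $d_r=O(1)$, $\underline d=\Omega(1)$ such that for every $t=1,\dots,T$: (1) $\max_{v\in Q}\|y-v\|_\infty\le d_y$ for every $(r,x,y)\in\Omega_t$; (2) there is $(\tilde r_t,\tilde x_t,\tilde y_t)\in\mathrm{conv}(\Omega_t)$ with $\tilde r_t\ge\max_{(r,x,y)\in\Omega_t}r-d_r$ and $\{\tilde y_t\}+\underline dB_m\subseteq\Psi$, where $B_m$ is the unit Euclidean ball of $\mathbb R^m$. Primal-dual algorithm. Set $p_1=\mathbf 0$. For $t=1,\dots,T$: choose $(r_t,x_t,y_t)\in\arg\max\{r-p_t^\top y:(r,x,y)\in\Omega_t\}$; choose $v_t\in\arg\max_{v\in Q}p_t^\top v$ (any such $v_t$ also maximizes $p_t^\top v$ over $\Psi$ since $p_t\in C^\circ$); set $p_{t+1}=\mathrm{proj}_{C^\circ}(p_t-\eta_t(v_t-y_t))$. *)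

theory Defs
  imports "HOL-Analysis.Analysis"
begin

text \<open>
  The dimension m is quantified under an existential (the constant in the bound must not depend
  on it), and the dimensions of the auxiliary variables vary with t, so they cannot be type
  indices.  All spaces are therefore realised inside one real inner product space: finitely
  supported real sequences with the standard inner product.  The subspace \<open>Rn m\<close> of sequences
  supported on \<open>{..<m}\<close> is an isometric copy of Euclidean m-space.  It is a closed subspace, so
  closedness, compactness, convexity of and distance to a subset
  of \<open>Rn m\<close> mean the same in the ambient space as in \<open>Rn m\<close>.  (The library's type of finitely
  supported functions already carries a different metric, the l1 metric, hence the new type.)
\<close>

typedef rvec = "{f :: nat \<Rightarrow> real. finite {i. f i \<noteq> 0}}"
  morphisms coord Abs_rvec
  by (rule exI [of _ "\<lambda>_. 0"]) simp

setup_lifting type_definition_rvec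

lemma rvec_eqI: "(\<And>i. coord u i = coord v i) \<Longrightarrow> u = v"
  by (simp add: coord_inject [symmetric] fun_eq_iff)

lemma finite_supp_coord [simp]: "finite {i. coord v i \<noteq> 0}"
  using coord [of v] by simp

instantiation rvec :: real_vector
begin

lift_definition zero_rvec :: rvec is "\<lambda>_. 0" by simp

lift_definition plus_rvec :: "rvec \<Rightarrow> rvec \<Rightarrow> rvec" is "\<lambda>f g i. f i + g i"
  subgoal for f g
    by (rule finite_subset [of _ "{i. f i \<noteq> 0} \<union> {i. g i \<noteq> 0}"]) auto
  done

lift_definition minus_rvec :: "rvec \<Rightarrow> rvec \<Rightarrow> rvec" is "\<lambda>f g i. f i - g i"
  subgoal for f g
    by (rule finite_subset [of _ "{i. f i \<noteq> 0} \<union> {i. g i \<noteq> 0}"]) auto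
  done

lift_definition uminus_rvec :: "rvec \<Rightarrow> rvec" is "\<lambda>f i. - f i" by simp

lift_definition scaleR_rvec :: "real \<Rightarrow> rvec \<Rightarrow> rvec" is "\<lambda>c f i. c * f i"
  subgoal for c f
    by (rule finite_subset [of _ "{i. f i \<noteq> 0}"]) auto
  done

instance
  by standard (transfer; simp add: fun_eq_iff algebra_simps)+

end

lemma coord_zero [simp]: "coord 0 i = 0"
  by transfer simp

lemma coord_add [simp]: "coord (u + v) i = coord u i + coord v i"
  by transfer simp

lemma coord_diff [simp]: "coord (u - v) i = coord u i - coord v i"
  by transfer simp

lemma coord_minus [simp]: "coord (- u) i = - coord u i"
  by transfer simp

lemma coord_scaleR [simp]: "coord (c *\<^sub>R u) i = c * coord u i"
  by transfer simp

lemma coord_sum [simp]: "coord (\<Sum>a\<in>A. f a) i = (\<Sum>a\<in>A. coord (f a) i)"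
  by (induction A rule: infinite_finite_induct) auto

definition inner_rvec_sum :: "rvec \<Rightarrow> rvec \<Rightarrow> real" where
  "inner_rvec_sum u v = (\<Sum>i | coord u i \<noteq> 0. coord u i * coord v i)"

lemma inner_rvec_sum_superset:
  assumes "finite A" "{i. coord u i \<noteq> 0} \<subseteq> A"
  shows "inner_rvec_sum u v = (\<Sum>i\<in>A. coord u i * coord v i)"
  unfolding inner_rvec_sum_def using assms by (intro sum.mono_neutral_left) auto

instantiation rvec :: real_inner
begin

definition inner_rvec :: "rvec \<Rightarrow> rvec \<Rightarrow> real" where
  "inner_rvec = inner_rvec_sum"

definition norm_rvec :: "rvec \<Rightarrow> real" where
  "norm_rvec v = sqrt (inner v v)"

definition sgn_rvec :: "rvec \<Rightarrow> rvec" where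
  "sgn_rvec v = v /\<^sub>R norm v"

definition dist_rvec :: "rvec \<Rightarrow> rvec \<Rightarrow> real" where
  "dist_rvec u v = norm (u - v)"

definition uniformity_rvec :: "(rvec \<times> rvec) filter" where
  "uniformity_rvec = (INF e\<in>{0<..}. principal {(u, v). dist u v < e})"

definition open_rvec :: "rvec set \<Rightarrow> bool" where
  "open_rvec U = (\<forall>u\<in>U. eventually (\<lambda>(u', v). u' = u \<longrightarrow> v \<in> U) uniformity)"

instance
proof
  fix u v w :: rvec and c :: real
  let ?S = "\<lambda>u. {i. coord u i \<noteq> 0}"
  have uv: "inner u v = (\<Sum>i\<in>?S u \<union> ?S v \<union> ?S w. coord u i * coord v i)" for u v w :: rvec
    unfolding inner_rvec_def by (rule inner_rvec_sum_superset) auto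
  show "inner u v = inner v u"
    unfolding uv [of u v u] uv [of v u v] by (auto intro!: sum.cong)
  have "inner (u + v) w = (\<Sum>i\<in>?S u \<union> ?S v \<union> ?S w. coord (u + v) i * coord w i)"
    unfolding inner_rvec_def by (rule inner_rvec_sum_superset) auto
  also have "\<dots> = (\<Sum>i\<in>?S u \<union> ?S v \<union> ?S w. coord u i * coord w i)
                + (\<Sum>i\<in>?S u \<union> ?S v \<union> ?S w. coord v i * coord w i)"
    by (simp add: distrib_right sum.distrib)
  also have "(\<Sum>i\<in>?S u \<union> ?S v \<union> ?S w. coord u i * coord w i) = inner u w"
    unfolding inner_rvec_def by (rule inner_rvec_sum_superset [symmetric]) auto
  also have "(\<Sum>i\<in>?S u \<union> ?S v \<union> ?S w. coord v i * coord w i) = inner v w"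
    unfolding inner_rvec_def by (rule inner_rvec_sum_superset [symmetric]) auto
  finally show "inner (u + v) w = inner u w + inner v w" .
  have "inner (c *\<^sub>R u) v = (\<Sum>i\<in>?S u. coord (c *\<^sub>R u) i * coord v i)"
    unfolding inner_rvec_def by (rule inner_rvec_sum_superset) auto
  then show "inner (c *\<^sub>R u) v = c * inner u v"
    by (simp add: inner_rvec_def inner_rvec_sum_def sum_distrib_left mult.assoc)
  show "0 \<le> inner u u"
    by (simp add: inner_rvec_def inner_rvec_sum_def sum_nonneg)
  show "inner u u = 0 \<longleftrightarrow> u = 0"
  proof
    assume "inner u u = 0"
    then have "\<forall>i\<in>?S u. coord u i * coord u i = 0"
      unfolding inner_rvec_def inner_rvec_sum_def by (subst (asm) sum_nonneg_eq_0_iff) auto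
    then show "u = 0"
      by (intro rvec_eqI) auto
  qed (simp add: inner_rvec_def inner_rvec_sum_def)
qed (simp_all add: norm_rvec_def sgn_rvec_def dist_rvec_def uniformity_rvec_def open_rvec_def)

end

definition Rn :: "nat \<Rightarrow> rvec set" where
  "Rn m = {v. \<forall>i\<ge>m. coord v i = 0}"

lemma inner_Rn:
  assumes "u \<in> Rn m"
  shows "u \<bullet> v = (\<Sum>i<m. coord u i * coord v i)"
  unfolding inner_rvec_def using assms
  by (intro inner_rvec_sum_superset) (auto simp: Rn_def not_less [symmetric])

lemma norm_Rn:
  assumes "u \<in> Rn m"
  shows "norm u = sqrt (\<Sum>i<m. (coord u i)\<^sup>2)"
  by (simp add: norm_eq_sqrt_inner inner_Rn [OF assms] power2_eq_square)

lemma subspace_Rn: "subspace (Rn m)"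
  by (auto simp: subspace_def Rn_def)

lemma coord_le_norm: "\<bar>coord v i\<bar> \<le> norm v"
proof -
  have "(coord v i)\<^sup>2 \<le> (\<Sum>j\<in>insert i {j. coord v j \<noteq> 0}. (coord v j)\<^sup>2)"
    by (rule member_le_sum) auto
  also have "\<dots> = inner v v"
    unfolding inner_rvec_def power2_eq_square by (rule inner_rvec_sum_superset [symmetric]) auto
  finally have "(coord v i)\<^sup>2 \<le> inner v v" .
  then show ?thesis
    unfolding norm_eq_sqrt_inner by (metis real_sqrt_abs real_sqrt_le_iff)
qed

lemma bounded_linear_coord: "bounded_linear (\<lambda>v. coord v i)"
  by (rule bounded_linear_intro [where K = 1]) (auto simp: coord_le_norm)

lemma closed_Rn: "closed (Rn m)"
proof -
  have "Rn m = (\<Inter>i\<in>{m..}. {v. coord v i = 0})"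
    by (auto simp: Rn_def)
  also have "closed \<dots>"
    by (intro closed_INT ballI closed_Collect_eq continuous_intros
        linear_continuous_on bounded_linear_coord)
  finally show ?thesis .
qed

definition inf_norm :: "rvec \<Rightarrow> real" where
  "inf_norm v = (SUP i. \<bar>coord v i\<bar>)"

definition polar_cone :: "nat \<Rightarrow> rvec set \<Rightarrow> rvec set" where
  "polar_cone m C = {p \<in> Rn m. \<forall>c\<in>C. p \<bullet> c \<le> 0}"

definition is_proj :: "rvec set \<Rightarrow> rvec \<Rightarrow> rvec \<Rightarrow> bool" where
  "is_proj S a q \<longleftrightarrow> is_arg_min (dist a) (\<lambda>z. z \<in> S) q"

text \<open>
  The library predicate \<^const>\<open>convex_cone\<close> includes nonemptiness.
  For \<open>Q\<close> and \<open>C\<close> as below, \<open>C\<close> is automatically the recession cone of \<open>\<Psi>\<close>.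
\<close>

definition motzkin_decomposition :: "nat \<Rightarrow> rvec set \<Rightarrow> rvec set \<Rightarrow> rvec set \<Rightarrow> bool" where
  "motzkin_decomposition m \<Psi> Q C \<longleftrightarrow>
     \<Psi> \<subseteq> Rn m \<and> closed \<Psi> \<and> convex \<Psi> \<and>
     Q \<subseteq> Rn m \<and> Q \<noteq> {} \<and> compact Q \<and> convex Q \<and>
     C \<subseteq> Rn m \<and> closed C \<and> convex_cone C \<and>
     \<Psi> = Q + C"

text \<open>A decision (r, x, y): reward, auxiliary variable, fairness impact.\<close>

type_synonym decision = "real \<times> rvec \<times> rvec"

definition local_feasible_sets ::
    "nat \<Rightarrow> nat \<Rightarrow> (nat \<Rightarrow> nat) \<Rightarrow> (nat \<Rightarrow> decision set) \<Rightarrow> bool" where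
  "local_feasible_sets m T n \<Omega> \<longleftrightarrow>
     (\<forall>t\<in>{1..T}. \<Omega> t \<subseteq> UNIV \<times> Rn (n t) \<times> Rn m \<and> \<Omega> t \<noteq> {} \<and> compact (\<Omega> t))"

definition convexified_feasible :: "nat \<Rightarrow> (nat \<Rightarrow> decision set) \<Rightarrow> rvec set \<Rightarrow> bool" where
  "convexified_feasible T \<Omega> \<Psi> \<longleftrightarrow>
     (\<exists>r x y. (\<forall>t\<in>{1..T}. (r t, x t, y t) \<in> convex hull (\<Omega> t)) \<and>
              (\<Sum>t=1..T. y t) \<in> (*\<^sub>R) (real T) ` \<Psi>)"

definition regularity ::
    "nat \<Rightarrow> nat \<Rightarrow> real \<Rightarrow> real \<Rightarrow> real \<Rightarrow> (nat \<Rightarrow> decision set) \<Rightarrow> rvec set \<Rightarrow> rvec set \<Rightarrow> bool"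
  where
  "regularity m T dy dr dlow \<Omega> \<Psi> Q \<longleftrightarrow>
     (\<forall>t\<in>{1..T}.
        (\<forall>(r, x, y)\<in>\<Omega> t. \<forall>v\<in>Q. inf_norm (y - v) \<le> dy) \<and>
        (\<exists>(r', x', y')\<in>convex hull (\<Omega> t).
           r' \<ge> (SUP (r, x, y)\<in>\<Omega> t. r) - dr \<and>
           {y'} + (*\<^sub>R) dlow ` (cball 0 1 \<inter> Rn m) \<subseteq> \<Psi>))"

text \<open>
  A run is any trajectory consistent with the updates; ties in the two maximisations are broken
  arbitrarily.
\<close>

definition primal_dual_run ::
    "nat \<Rightarrow> nat \<Rightarrow> (nat \<Rightarrow> real) \<Rightarrow> (nat \<Rightarrow> decision set) \<Rightarrow> rvec set \<Rightarrow> rvec set \<Rightarrow>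
     (nat \<Rightarrow> rvec) \<Rightarrow> (nat \<Rightarrow> real) \<Rightarrow> (nat \<Rightarrow> rvec) \<Rightarrow> (nat \<Rightarrow> rvec) \<Rightarrow> (nat \<Rightarrow> rvec) \<Rightarrow> bool"
  where
  "primal_dual_run m T \<eta> \<Omega> Q C p r x y v \<longleftrightarrow>
     p 1 = 0 \<and>
     (\<forall>t\<in>{1..T}.
        is_arg_max (\<lambda>(r', x', y'). r' - p t \<bullet> y') (\<lambda>z. z \<in> \<Omega> t) (r t, x t, y t) \<and>
        is_arg_max (\<lambda>v'. p t \<bullet> v') (\<lambda>v'. v' \<in> Q) (v t) \<and>
        is_proj (polar_cone m C) (p t - \<eta> t *\<^sub>R (v t - y t)) (p (t + 1)))"

end

theory Submission
  imports Defs
begin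

text \<open>
  Let \<open>g\<^sub>t = v\<^sub>t - y\<^sub>t\<close>.  The Slater points give \<open>p\<^sub>t \<bullet> g\<^sub>t \<ge> dlow \<parallel>p\<^sub>t\<parallel> - dr\<close>, and since
  \<open>\<parallel>g\<^sub>t\<parallel>\<^sup>2 \<le> m dy\<^sup>2\<close> and \<open>\<eta>\<^sub>t m \<le> 1\<close>, the squared norm of the dual iterate grows by at most
  \<open>\<eta>\<^sub>t (K - 2 dlow \<parallel>p\<^sub>t\<parallel>)\<close> per step, where \<open>K = 2 dr + dy\<^sup>2\<close>.  Hence \<open>\<parallel>p\<^sub>t\<parallel>\<close> stays below a
  constant, and also \<open>\<parallel>p\<^sub>t\<parallel>\<^sup>2 \<le> K \<Sum>\<^sub>s\<^sub><\<^sub>t \<eta>\<^sub>s\<close>.  By Moreau's decomposition,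
  \<open>p\<^sub>t - \<eta>\<^sub>t g\<^sub>t = p\<^sub>t\<^sub>+\<^sub>1 + c\<^sub>t\<close> with \<open>c\<^sub>t \<in> C\<close>, so \<open>y\<^sub>t = (v\<^sub>t + c\<^sub>t / \<eta>\<^sub>t) + (p\<^sub>t\<^sub>+\<^sub>1 - p\<^sub>t) / \<eta>\<^sub>t\<close>.
  The first summands add up to a point of \<open>T \<Psi>\<close>; the second ones are summed by parts, and
  their sum is at most \<open>2 max\<^sub>t \<parallel>p\<^sub>t\<parallel> / \<eta>\<^sub>T\<close>.  If \<open>T > m\<close>, then \<open>1 / \<eta>\<^sub>T = \<surd>(m T)\<close> and the constant
  bound on \<open>\<parallel>p\<^sub>t\<parallel>\<close> suffices; if \<open>T \<le> m\<close>, then \<open>1 / \<eta>\<^sub>T = m\<close> and one needs the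
  second bound, which gives \<open>\<parallel>p\<^sub>t\<parallel> \<le> \<surd>(K T / m)\<close>.
\<close>

section \<open>Compactness, nearest points and Moreau's decomposition in \<open>Rn m\<close>\<close>

text \<open>The ambient space is infinite-dimensional, so compactness is recovered one coordinate at
  a time: the ball in \<open>Rn (Suc m)\<close> is a closed subset of a continuous image of the ball
  in \<open>Rn m\<close> times an interval.\<close>

lemma compact_cball_Rn: "compact (cball 0 r \<inter> Rn m)"
proof (induction m)
  case 0
  have "cball 0 r \<inter> Rn 0 \<subseteq> {0}"
    by (auto simp: Rn_def intro: rvec_eqI)
  then show ?case
    by (metis finite.emptyI finite_imp_compact finite_insert finite_subset)
next
  case (Suc m)
  define e where "e = Abs_rvec (\<lambda>i. of_bool (i = m))"
  have e: "coord e i = of_bool (i = m)" for i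
    unfolding e_def by (subst Abs_rvec_inverse) auto
  let ?g = "\<lambda>(u, a :: real). u + a *\<^sub>R e"
  have "compact (?g ` ((cball 0 r \<inter> Rn m) \<times> {-r..r}))"
    by (intro compact_continuous_image compact_Times Suc compact_Icc)
      (auto simp: split_beta intro!: continuous_intros)
  moreover have "cball 0 r \<inter> Rn (Suc m) \<subseteq> ?g ` ((cball 0 r \<inter> Rn m) \<times> {-r..r})"
  proof
    fix w assume w: "w \<in> cball 0 r \<inter> Rn (Suc m)"
    let ?u = "w - coord w m *\<^sub>R e"
    have u: "?u \<in> Rn m"
      using w by (auto simp: Rn_def e le_Suc_eq not_less_eq_eq [symmetric])
    have "norm ?u \<le> norm w"
      using w unfolding norm_Rn [OF u] by (simp add: norm_Rn [of w "Suc m"] e)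
    moreover have "\<bar>coord w m\<bar> \<le> r"
      using w coord_le_norm [of w m] by simp
    ultimately show "w \<in> ?g ` ((cball 0 r \<inter> Rn m) \<times> {-r..r})"
      using w u by (intro image_eqI [of _ _ "(?u, coord w m)"]) auto
  qed
  ultimately show ?case
    by (metis Int_absorb1 closed_Int closed_cball closed_Rn compact_Int_closed)
qed

text \<open>Only points no farther from \<open>a\<close> than a fixed \<open>s\<close> in
  \<open>S\<close> compete, and they form a compact set even if \<open>a\<close> lies outside
  \<open>Rn m\<close>.\<close>

lemma nearest_point_Rn_exists:
  assumes "closed S" "S \<subseteq> Rn m" "S \<noteq> {}"
  obtains c where "c \<in> S" "\<And>z. z \<in> S \<Longrightarrow> dist a c \<le> dist a z"
proof -
  obtain s where s: "s \<in> S"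
    using assms by auto
  let ?K = "S \<inter> cball a (dist a s)"
  have "?K \<subseteq> cball 0 (norm a + dist a s) \<inter> Rn m"
  proof
    fix z assume z: "z \<in> ?K"
    have "norm z \<le> norm a + norm (z - a)"
      by (metis add.commute diff_add_cancel norm_triangle_ineq)
    with z show "z \<in> cball 0 (norm a + dist a s) \<inter> Rn m"
      using assms by (auto simp: dist_norm norm_minus_commute)
  qed
  then have "compact ?K"
    using assms by (metis Int_absorb1 closed_Int closed_cball compact_Int_closed compact_cball_Rn inf_commute)
  moreover have "continuous_on ?K (dist a)"
    by (intro continuous_intros)
  moreover have "?K \<noteq> {}"
    using s by auto
  ultimately obtain c where c: "c \<in> ?K" "\<And>z. z \<in> ?K \<Longrightarrow> dist a c \<le> dist a z"
    using continuous_attains_inf [of ?K "dist a"] by blast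
  show thesis
  proof (rule that)
    fix z assume "z \<in> S"
    then show "dist a c \<le> dist a z"
      using c by (cases "dist a z \<le> dist a s") auto
  qed (use c in auto)
qed

text \<open>For the nearest point \<open>c\<close> of \<open>C\<close>, the residual
  \<open>a - c\<close> lies in the polar cone and is orthogonal to \<open>c\<close>. No other point
  of the polar cone is as close to \<open>a\<close>, so \<open>q = a - c\<close>.\<close>

lemma moreau_decomposition:
  assumes C: "C \<subseteq> Rn m" "closed C" "convex_cone C" and "a \<in> Rn m"
    and q: "is_proj (polar_cone m C) a q"
  shows "a - q \<in> C" and "q \<bullet> (a - q) = 0"
proof -
  obtain c where c: "c \<in> C" "\<And>z. z \<in> C \<Longrightarrow> dist a c \<le> dist a z"
    using nearest_point_Rn_exists C convex_cone_nonempty by metis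
  have dot: "(a - c) \<bullet> (z - c) \<le> 0" if "z \<in> C" for z
    using any_closest_point_dot [of C c z a] C c that by (auto simp: convex_cone_def)
  \<comment> \<open>Moving along the ray of \<open>c\<close> both ways, to \<open>0\<close> and to
    \<open>2 *\<^sub>R c\<close>, turns the inequality into an equality.\<close>
  have orth: "(a - c) \<bullet> c = 0"
    using dot [of 0] dot [of "2 *\<^sub>R c"] C c
    by (simp add: convex_cone_contains_0 convex_cone_scaleR algebra_simps)
  have polar: "a - c \<in> polar_cone m C"
    using dot orth C c \<open>a \<in> Rn m\<close> subspace_diff [OF subspace_Rn]
    by (auto simp: polar_cone_def inner_diff_right)
  have "q \<in> polar_cone m C"
    using q by (simp add: is_proj_def is_arg_min_def)
  then have "c \<bullet> q \<le> 0"
    using c by (simp add: polar_cone_def inner_commute)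
  have "dist a q \<le> dist a (a - c)"
    using q polar by (auto simp: is_proj_def is_arg_min_def not_less)
  \<comment> \<open>Here \<open>a - q\<close> is written as \<open>c\<close> plus the difference of
    the two candidates; the cross term is nonnegative, which forces that difference to
    vanish.\<close>
  then have "(norm (c + (a - c - q)))\<^sup>2 \<le> (norm c)\<^sup>2"
    by (simp add: dist_norm)
  moreover have "(norm (c + (a - c - q)))\<^sup>2 = (norm c)\<^sup>2 + 2 * (c \<bullet> (a - c - q)) + (norm (a - c - q))\<^sup>2"
    using dot_norm [of c "a - c - q"] by simp
  moreover have "c \<bullet> (a - c - q) \<ge> 0"
    using orth \<open>c \<bullet> q \<le> 0\<close> by (simp add: inner_diff_right inner_diff_left inner_commute)
  ultimately have "(norm (a - c - q))\<^sup>2 \<le> 0"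
    by linarith
  then have "q = a - c"
    by simp
  with c orth show "a - q \<in> C" "q \<bullet> (a - q) = 0"
    by auto
qed

section \<open>Drift and size of the dual iterates\<close>

lemma norm_le_sqrt_inf_norm:
  assumes "u \<in> Rn m" "inf_norm u \<le> d"
  shows "norm u \<le> d * sqrt (real m)"
proof -
  have bdd: "bdd_above (range (\<lambda>i. \<bar>coord u i\<bar>))"
    by (rule bdd_aboveI [of _ "norm u"]) (auto simp: coord_le_norm)
  have le: "\<bar>coord u i\<bar> \<le> d" for i
    using cSUP_upper [OF UNIV_I bdd, of i] assms by (simp add: inf_norm_def)
  then have "d \<ge> 0"
    by (meson abs_ge_zero order_trans)
  have "(\<Sum>i<m. (coord u i)\<^sup>2) \<le> (\<Sum>i<m. d\<^sup>2)"
    using le by (intro sum_mono) (metis abs_ge_zero power2_abs power_mono)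
  then have "norm u \<le> sqrt (real m * d\<^sup>2)"
    unfolding norm_Rn [OF assms(1)] by (simp add: real_sqrt_le_mono)
  with \<open>d \<ge> 0\<close> show ?thesis
    by (simp add: real_sqrt_mult mult.commute)
qed

text \<open>Both maximisations are tested near the Slater point. Optimality over
  \<open>\<Omega>\<close> passes to its hull because the objective is linear, and shifting
  \<open>y'\<close> by \<open>d\<close> in the direction of \<open>p\<close> stays in
  \<open>\<Psi>\<close>, which yields the margin \<open>d * norm p\<close>.\<close>

lemma slater_drift:
  fixes \<Omega> :: "decision set"
  assumes \<Omega>: "compact \<Omega>" "(r, x, y) \<in> \<Omega>"
    and opt: "\<And>r' x' y'. (r', x', y') \<in> \<Omega> \<Longrightarrow> r' - p \<bullet> y' \<le> r - p \<bullet> y"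
    and v: "\<And>w. w \<in> \<Psi> \<Longrightarrow> p \<bullet> w \<le> p \<bullet> v"
    and hull: "(r', x', y') \<in> convex hull \<Omega>"
    and r': "r' \<ge> (SUP (r, x, y)\<in>\<Omega>. r) - dr"
    and ball: "{y'} + (*\<^sub>R) d ` (cball 0 1 \<inter> Rn m) \<subseteq> \<Psi>"
    and p: "p \<in> Rn m"
  shows "d * norm p - dr \<le> p \<bullet> (v - y)"
proof -
  have "bdd_above (fst ` \<Omega>)"
    by (intro bounded_imp_bdd_above compact_imp_bounded compact_continuous_image \<Omega>
        continuous_intros)
  then have "r \<le> (SUP z\<in>\<Omega>. fst z)"
    using cSUP_upper [OF \<Omega>(2), of fst] by simp
  then have r: "r \<le> r' + dr"
    using r' by (simp add: case_prod_unfold)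
  let ?H = "{z :: real \<times> rvec \<times> rvec. (1, 0, - p) \<bullet> z \<le> r - p \<bullet> y}"
  have "\<Omega> \<subseteq> ?H"
    using opt by (auto simp: inner_prod_def)
  then have "convex hull \<Omega> \<subseteq> ?H"
    by (intro hull_minimal convex_halfspace_le)
  then have opt': "r' - p \<bullet> y' \<le> r - p \<bullet> y"
    using hull by (auto simp: inner_prod_def)
  have "sgn p \<in> cball 0 1 \<inter> Rn m"
    using p subspace_scale [OF subspace_Rn p, of "inverse (norm p)"]
    by (simp add: norm_sgn sgn_div_norm [symmetric])
  then have "y' + d *\<^sub>R sgn p \<in> {y'} + (*\<^sub>R) d ` (cball 0 1 \<inter> Rn m)"
    by (auto simp: set_plus_def)
  with ball have "p \<bullet> (y' + d *\<^sub>R sgn p) \<le> p \<bullet> v"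
    by (intro v) auto
  moreover have "p \<bullet> sgn p = norm p"
    by (cases "p = 0") (simp_all add: sgn_div_norm dot_square_norm power2_eq_square)
  ultimately have "p \<bullet> y' + d * norm p \<le> p \<bullet> v"
    by (simp add: inner_add_right)
  with r opt' show ?thesis
    by (simp add: inner_diff_right)
qed

text \<open>The condition \<open>\<eta> * m \<le> 1\<close> spends one factor \<open>\<eta>\<close>
  of the quadratic term on the dimension, leaving a bound free of \<open>m\<close>.\<close>

lemma dual_step_norm:
  fixes p g :: "'a::real_inner"
  assumes "norm p' \<le> norm (p - \<eta> *\<^sub>R g)" "d * norm p - dr \<le> p \<bullet> g" "norm g \<le> dy * sqrt m"
    and \<eta>: "0 \<le> \<eta>" "\<eta> * m \<le> 1" and "m \<ge> 0"
  shows "(norm p')\<^sup>2 \<le> (norm p)\<^sup>2 + \<eta> * (2 * dr + dy\<^sup>2 - 2 * d * norm p)"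
proof -
  have "(norm g)\<^sup>2 \<le> (dy * sqrt m)\<^sup>2"
    using assms by (intro power_mono) auto
  then have "\<eta>\<^sup>2 * (norm g)\<^sup>2 \<le> \<eta>\<^sup>2 * (dy\<^sup>2 * m)"
    using \<open>m \<ge> 0\<close> by (intro mult_left_mono) (auto simp: power_mult_distrib)
  also have "\<dots> = \<eta> * dy\<^sup>2 * (\<eta> * m)"
    by (simp add: power2_eq_square)
  also have "\<dots> \<le> \<eta> * dy\<^sup>2"
    using \<eta> mult_left_mono [of "\<eta> * m" 1 "\<eta> * dy\<^sup>2"] by simp
  finally have 1: "\<eta>\<^sup>2 * (norm g)\<^sup>2 \<le> \<eta> * dy\<^sup>2" .
  have 2: "\<eta> * (d * norm p - dr) \<le> \<eta> * (p \<bullet> g)"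
    using assms by (intro mult_left_mono) auto
  have "(norm p')\<^sup>2 \<le> (norm (p - \<eta> *\<^sub>R g))\<^sup>2"
    using assms by (intro power_mono) auto
  also have "\<dots> = (norm p)\<^sup>2 - 2 * (\<eta> * (p \<bullet> g)) + \<eta>\<^sup>2 * (norm g)\<^sup>2"
    unfolding power2_norm_eq_inner
    by (simp add: inner_diff_left inner_diff_right inner_commute power2_eq_square algebra_simps)
  also have "\<dots> \<le> (norm p)\<^sup>2 - 2 * (\<eta> * (d * norm p - dr)) + \<eta> * dy\<^sup>2"
    using 1 2 by linarith
  finally show ?thesis
    by (simp add: algebra_simps)
qed

text \<open>At norm \<open>(2 * dr + dy\<^sup>2) / (2 * d)\<close> the bracket in the one-step bound
  changes sign: from there on a step cannot increase the norm, and below it a step adds at most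
  \<open>dy\<close>.\<close>

lemma dual_iterates_bounds:
  fixes p g :: "nat \<Rightarrow> 'a::real_inner"
  assumes p1: "p 1 = 0"
    and step: "\<And>t. t \<in> {1..T} \<Longrightarrow> norm (p (Suc t)) \<le> norm (p t - \<eta> t *\<^sub>R g t)"
    and drift: "\<And>t. t \<in> {1..T} \<Longrightarrow> d * norm (p t) - dr \<le> p t \<bullet> g t"
    and g: "\<And>t. t \<in> {1..T} \<Longrightarrow> norm (g t) \<le> dy * sqrt m"
    and \<eta>: "\<And>t. t \<in> {1..T} \<Longrightarrow> 0 \<le> \<eta> t" "\<And>t. t \<in> {1..T} \<Longrightarrow> \<eta> t * m \<le> 1"
    and pos: "m \<ge> 1" "d > 0" "dr > 0" "dy > 0"
    and t: "t \<in> {1..Suc T}"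
  shows "norm (p t) \<le> (2 * dr + dy\<^sup>2) / (2 * d) + dy"
    and "(norm (p t))\<^sup>2 \<le> (2 * dr + dy\<^sup>2) * (\<Sum>s=1..<t. \<eta> s)"
proof -
  have sq: "(norm (p (Suc s)))\<^sup>2 \<le> (norm (p s))\<^sup>2 + \<eta> s * (2 * dr + dy\<^sup>2 - 2 * d * norm (p s))"
    if "s \<in> {1..T}" for s
    using dual_step_norm [OF step [OF that] drift [OF that] g [OF that] \<eta> [OF that]] pos by simp
  let ?K = "(2 * dr + dy\<^sup>2) / (2 * d)"
  have "norm (p t) \<le> ?K + dy \<and> (norm (p t))\<^sup>2 \<le> (2 * dr + dy\<^sup>2) * (\<Sum>s=1..<t. \<eta> s)"
    if "1 \<le> t" "t \<le> Suc T" for t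
    using that
  proof (induction t rule: nat_induct_at_least)
    case base
    show ?case
      using pos p1 by simp
  next
    case (Suc t)
    then have tT: "t \<in> {1..T}"
      by simp
    then have IH: "norm (p t) \<le> ?K + dy" "(norm (p t))\<^sup>2 \<le> (2 * dr + dy\<^sup>2) * (\<Sum>s=1..<t. \<eta> s)"
      using Suc by auto
    have "norm (p (Suc t)) \<le> ?K + dy"
    proof (cases "norm (p t) \<ge> ?K")
      case True
      then have "2 * dr + dy\<^sup>2 - 2 * d * norm (p t) \<le> 0"
        using pos by (simp add: field_simps)
      then have "\<eta> t * (2 * dr + dy\<^sup>2 - 2 * d * norm (p t)) \<le> 0"
        using \<eta>(1) [OF tT] by (simp add: mult_nonneg_nonpos)
      with sq [OF tT] have "(norm (p (Suc t)))\<^sup>2 \<le> (norm (p t))\<^sup>2"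
        by linarith
      then have "norm (p (Suc t)) \<le> norm (p t)"
        by simp
      then show ?thesis
        using IH by linarith
    next
      case False
      have "sqrt m \<le> m"
        using pos by (simp add: real_sqrt_le_iff' power2_eq_square mult_le_cancel_left1 real_le_lsqrt)
      then have "\<eta> t * sqrt m \<le> 1"
        using \<eta> [OF tT] by (meson mult_left_mono order_trans)
      then have "dy * (\<eta> t * sqrt m) \<le> dy"
        using pos by (simp add: mult_left_le)
      moreover have "\<eta> t * norm (g t) \<le> \<eta> t * (dy * sqrt m)"
        using g \<eta>(1) tT by (intro mult_left_mono) auto
      moreover have "norm (p (Suc t)) \<le> norm (p t) + norm (\<eta> t *\<^sub>R g t)"
        using step [OF tT] norm_triangle_ineq4 [of "p t" "\<eta> t *\<^sub>R g t"] by linarith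
      ultimately show ?thesis
        using False \<eta>(1) [OF tT] by (simp add: mult.left_commute)
    qed
    \<comment> \<open>For the second bound this term is simply discarded.\<close>
    moreover have "\<eta> t * (2 * d * norm (p t)) \<ge> 0"
      using \<eta>(1) [OF tT] pos by simp
    then have "(norm (p (Suc t)))\<^sup>2 \<le> (2 * dr + dy\<^sup>2) * (\<Sum>s=1..<Suc t. \<eta> s)"
      using sq [OF tT] IH(2) tT by (simp add: algebra_simps)
    ultimately show ?case
      by blast
  qed
  with t show "norm (p t) \<le> ?K + dy" "(norm (p t))\<^sup>2 \<le> (2 * dr + dy\<^sup>2) * (\<Sum>s=1..<t. \<eta> s)"
    by auto
qed

section \<open>Summation by parts and averaging\<close>

lemma norm_sum_scaled_increments_le:
  fixes p :: "nat \<Rightarrow> 'a::real_normed_vector" and a :: "nat \<Rightarrow> real"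
  assumes "p 1 = 0" "incseq a" "a 0 \<ge> 0" and P: "\<And>t. t \<in> {1..Suc T} \<Longrightarrow> norm (p t) \<le> P"
  shows "norm (\<Sum>t=1..T. a t *\<^sub>R (p (Suc t) - p t)) \<le> 2 * a T * P"
proof -
  define S where "S k = (\<Sum>t=1..k. a t *\<^sub>R (p (Suc t) - p t))" for k
  have "P \<ge> 0"
    using order_trans [OF norm_ge_zero P [of 1]] by simp
  \<comment> \<open>With the boundary term removed, each step adds only
    \<open>a (Suc k) - a k\<close> times one iterate, so the weights telescope. At
    \<open>k = 0\<close> the expression vanishes because \<open>p 1 = 0\<close>.\<close>
  have "k \<le> T \<Longrightarrow> norm (S k - a k *\<^sub>R p (Suc k)) \<le> a k * P" for k
  proof (induction k)
    case 0
    then show ?case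
      using assms \<open>P \<ge> 0\<close> by (simp add: S_def)
  next
    case (Suc k)
    have le: "a k \<le> a (Suc k)"
      using \<open>incseq a\<close> by (simp add: incseq_SucD)
    have "norm (S (Suc k) - a (Suc k) *\<^sub>R p (Suc (Suc k)))
        = norm ((S k - a k *\<^sub>R p (Suc k)) - (a (Suc k) - a k) *\<^sub>R p (Suc k))"
      by (simp add: S_def algebra_simps)
    also have "\<dots> \<le> norm (S k - a k *\<^sub>R p (Suc k)) + (a (Suc k) - a k) * norm (p (Suc k))"
      using norm_triangle_ineq4 [of "S k - a k *\<^sub>R p (Suc k)" "(a (Suc k) - a k) *\<^sub>R p (Suc k)"] le
      by simp
    also have "\<dots> \<le> a k * P + (a (Suc k) - a k) * P"
      using Suc P [of "Suc k"] le by (intro add_mono mult_left_mono) auto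
    finally show ?case
      by (simp add: algebra_simps)
  qed
  then have "norm (S T - a T *\<^sub>R p (Suc T)) \<le> a T * P"
    by simp
  moreover have "a T \<ge> 0"
    using assms incseqD [of a 0 T] by simp
  then have "norm (a T *\<^sub>R p (Suc T)) \<le> a T * P"
    using P [of "Suc T"] by (simp add: mult_left_mono)
  moreover have "norm (S T) \<le> norm (S T - a T *\<^sub>R p (Suc T)) + norm (a T *\<^sub>R p (Suc T))"
    by (metis diff_add_cancel norm_triangle_ineq)
  ultimately show ?thesis
    unfolding S_def by linarith
qed

text \<open>Averages stay in \<open>Q\<close> and in \<open>C\<close> by convexity, and the factor
  \<open>T\<close> undoes the averaging.\<close>

lemma sum_mem_scaled_motzkin:
  assumes "convex Q" "convex_cone C" "T \<ge> 1"
    and v: "\<And>t. t \<in> {1..T} \<Longrightarrow> v t \<in> Q" and c: "\<And>t. t \<in> {1..T} \<Longrightarrow> c t \<in> C"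
  shows "(\<Sum>t=1..T. v t + c t) \<in> (*\<^sub>R) (real T) ` (Q + C)"
proof -
  have "(\<Sum>t=1..T. (1 / real T) *\<^sub>R v t) \<in> Q"
    using assms by (intro convex_sum) auto
  moreover have "(\<Sum>t=1..T. (1 / real T) *\<^sub>R c t) \<in> C"
    using assms by (intro convex_sum) (auto simp: convex_cone_def)
  moreover have "(\<Sum>t=1..T. v t + c t)
      = real T *\<^sub>R ((\<Sum>t=1..T. (1 / real T) *\<^sub>R v t) + (\<Sum>t=1..T. (1 / real T) *\<^sub>R c t))"
    using \<open>T \<ge> 1\<close> by (simp add: sum.distrib scaleR_sum_right [symmetric] scaleR_add_right)
  ultimately show ?thesis
    by (auto simp: set_plus_def)
qed

section \<open>Assembly of the violation bound\<close>

theorem theorem4p6: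
  fixes dy dr dlow :: real
  assumes "dy > 0" and "dr > 0" and "dlow > 0"
  shows "\<exists>M :: real. \<forall>(m :: nat) (T :: nat) (n :: nat \<Rightarrow> nat)
           (\<Omega> :: nat \<Rightarrow> decision set) \<Psi> Q C (\<eta> :: nat \<Rightarrow> real) p r x y v.
           m \<ge> 1 \<longrightarrow> T \<ge> 1 \<longrightarrow>
           local_feasible_sets m T n \<Omega> \<longrightarrow>
           motzkin_decomposition m \<Psi> Q C \<longrightarrow>
           convexified_feasible T \<Omega> \<Psi> \<longrightarrow>
           regularity m T dy dr dlow \<Omega> \<Psi> Q \<longrightarrow>
           (\<forall>t\<in>{1..T}. \<eta> t = min (1 / real m) (1 / sqrt (real m * real t))) \<longrightarrow>
           primal_dual_run m T \<eta> \<Omega> Q C p r x y v \<longrightarrow>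
           infdist (\<Sum>t=1..T. y t) ((*\<^sub>R) (real T) ` \<Psi>) \<le> M * sqrt (real m * real T)"
proof -
  define K where "K = 2 * dr + dy\<^sup>2"
  define P where "P = K / (2 * dlow) + dy"
  have "K > 0"
    using assms by (simp add: K_def add_pos_nonneg)
  have "P > 0"
    using assms \<open>K > 0\<close> by (simp add: P_def add_pos_pos)
  show ?thesis
  \<comment> \<open>The factor 2 comes from summation by parts; \<open>P\<close> serves the case
    \<open>T > m\<close> and \<open>sqrt K\<close> the case \<open>T \<le> m\<close>.\<close>
  proof (intro exI [of _ "2 * max P (sqrt K)"] allI impI)
    fix m T :: nat and n :: "nat \<Rightarrow> nat" and \<Omega> :: "nat \<Rightarrow> decision set"
      and \<Psi> Q C :: "rvec set" and \<eta> r :: "nat \<Rightarrow> real" and p x y v :: "nat \<Rightarrow> rvec"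
    assume m: "m \<ge> 1" and T: "T \<ge> 1"
      and loc: "local_feasible_sets m T n \<Omega>"
      and motzkin: "motzkin_decomposition m \<Psi> Q C"
      and reg: "regularity m T dy dr dlow \<Omega> \<Psi> Q"
      and \<eta>: "\<forall>t\<in>{1..T}. \<eta> t = min (1 / real m) (1 / sqrt (real m * real t))"
      and run: "primal_dual_run m T \<eta> \<Omega> Q C p r x y v"
    note C = motzkin [unfolded motzkin_decomposition_def]
    \<comment> \<open>The reciprocal step size, extended to \<open>t = 0\<close> by the value
      \<open>m\<close>, so that it is monotone and nonnegative from index 0 on.\<close>
    define a where "a t = max (real m) (sqrt (real m * real t))" for t
    have a: "a t \<ge> real m" "a t > 0" for t
      using m by (auto simp: a_def)
    have \<eta>a: "\<eta> t = 1 / a t" if "t \<in> {1..T}" for t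
      using \<eta> that m by (auto simp: a_def min_def max_def field_simps)
    have p1: "p 1 = 0"
      using run by (simp add: primal_dual_run_def)
    have dec: "(r t, x t, y t) \<in> \<Omega> t"
      and opt: "\<And>r' x' y'. (r', x', y') \<in> \<Omega> t \<Longrightarrow> r' - p t \<bullet> y' \<le> r t - p t \<bullet> y t"
      and vQ: "v t \<in> Q" and vmax: "\<And>w. w \<in> Q \<Longrightarrow> p t \<bullet> w \<le> p t \<bullet> v t"
      and proj: "is_proj (polar_cone m C) (p t - \<eta> t *\<^sub>R (v t - y t)) (p (Suc t))"
      if "t \<in> {1..T}" for t
      using run that by (fastforce simp: primal_dual_run_def is_arg_max_def not_less)+
    have polar: "p t \<in> polar_cone m C" if "t \<in> {1..Suc T}" for t
    proof (cases "t = 1")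
      case True
      then show ?thesis
        using p1 subspace_0 [OF subspace_Rn] by (simp add: polar_cone_def)
    next
      case False
      then have "t - 1 \<in> {1..T}"
        using that by auto
      from proj [OF this] False show ?thesis
        using that by (simp add: is_proj_def is_arg_min_def)
    qed
    then have pRn: "p t \<in> Rn m" if "t \<in> {1..Suc T}" for t
      using that by (simp add: polar_cone_def)
    have gRn: "v t - y t \<in> Rn m" if "t \<in> {1..T}" for t
    proof (rule subspace_diff [OF subspace_Rn])
      show "v t \<in> Rn m"
        using vQ [OF that] C by blast
      show "y t \<in> Rn m"
        using loc dec [OF that] that by (auto simp: local_feasible_sets_def)
    qed
    have g: "norm (v t - y t) \<le> dy * sqrt (real m)" if "t \<in> {1..T}" for t
    proof -
      have "inf_norm (y t - v t) \<le> dy"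
        using reg that dec [OF that] vQ [OF that] unfolding regularity_def by fastforce
      moreover have "y t - v t \<in> Rn m"
        using subspace_neg [OF subspace_Rn gRn [OF that]] by simp
      ultimately show ?thesis
        by (metis norm_le_sqrt_inf_norm norm_minus_commute)
    qed
    have \<Psi>max: "p t \<bullet> w \<le> p t \<bullet> v t" if t: "t \<in> {1..T}" and "w \<in> \<Psi>" for t w
    proof -
      obtain q c where "w = q + c" "q \<in> Q" "c \<in> C"
        using C \<open>w \<in> \<Psi>\<close> by (auto simp: set_plus_def)
      moreover have "p t \<bullet> c \<le> 0"
        using polar [of t] t \<open>c \<in> C\<close> by (auto simp: polar_cone_def)
      ultimately show ?thesis
        using vmax [OF t, of q] by (simp add: inner_add_right)
    qed
    have drift: "dlow * norm (p t) - dr \<le> p t \<bullet> (v t - y t)" if t: "t \<in> {1..T}" for t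
    proof -
      obtain r' x' y' where "(r', x', y') \<in> convex hull (\<Omega> t)"
        "r' \<ge> (SUP (r, x, y)\<in>\<Omega> t. r) - dr" "{y'} + (*\<^sub>R) dlow ` (cball 0 1 \<inter> Rn m) \<subseteq> \<Psi>"
        using reg t unfolding regularity_def by blast
      then show ?thesis
        using loc t dec opt \<Psi>max pRn [of t]
        by (intro slater_drift [of "\<Omega> t" "r t" "x t" "y t" "p t" \<Psi> "v t" r' x' y' dr dlow m])
          (auto simp: local_feasible_sets_def)
    qed
    \<comment> \<open>The part removed by the projection: it lies in \<open>C\<close> and is
      orthogonal to the new iterate, so Pythagoras gives \<open>step\<close>.\<close>
    define c where "c t = p t - \<eta> t *\<^sub>R (v t - y t) - p (Suc t)" for t
    have aRn: "p t - \<eta> t *\<^sub>R (v t - y t) \<in> Rn m" if "t \<in> {1..T}" for t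
      using pRn [of t] gRn that
      by (intro subspace_diff [OF subspace_Rn, of "p t"] subspace_scale [OF subspace_Rn]) auto
    have moreau: "c t \<in> C" "p (Suc t) \<bullet> c t = 0" if "t \<in> {1..T}" for t
      using moreau_decomposition [OF _ _ _ aRn proj] C that by (auto simp: c_def)
    have step: "norm (p (Suc t)) \<le> norm (p t - \<eta> t *\<^sub>R (v t - y t))" if "t \<in> {1..T}" for t
    proof -
      have "(norm (p (Suc t) + c t))\<^sup>2 = (norm (p (Suc t)))\<^sup>2 + (norm (c t))\<^sup>2"
        using moreau(2) [OF that] norm_add_Pythagorean [of "p (Suc t)" "c t"]
        by (simp add: orthogonal_def)
      then have "(norm (p (Suc t)))\<^sup>2 \<le> (norm (p (Suc t) + c t))\<^sup>2"
        by simp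
      moreover have "p (Suc t) + c t = p t - \<eta> t *\<^sub>R (v t - y t)"
        by (simp add: c_def)
      ultimately show ?thesis
        by (metis norm_ge_zero power2_le_imp_le)
    qed
    have \<eta>_bounds: "0 \<le> \<eta> t" "\<eta> t * real m \<le> 1" if "t \<in> {1..T}" for t
      using a [of t] by (simp_all add: \<eta>a [OF that])
    have bounds: "norm (p t) \<le> P" "(norm (p t))\<^sup>2 \<le> K * (\<Sum>s=1..<t. \<eta> s)" if "t \<in> {1..Suc T}" for t
      unfolding P_def K_def
      using dual_iterates_bounds [where g = "\<lambda>t. v t - y t", OF p1 step drift g \<eta>_bounds _ _ _ _ that]
        m assms by auto
    define R where "R = (\<Sum>t=1..T. a t *\<^sub>R (p (Suc t) - p t))"
    \<comment> \<open>The definition of \<open>c t\<close> solved for \<open>y t\<close>; scaling by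
      \<open>a t\<close> keeps \<open>c t\<close> in the cone.\<close>
    have "y t = (v t + a t *\<^sub>R c t) + a t *\<^sub>R (p (Suc t) - p t)" if "t \<in> {1..T}" for t
      using a(2) [of t] \<eta>a [OF that] by (simp add: c_def algebra_simps)
    then have "(\<Sum>t=1..T. y t) = (\<Sum>t=1..T. v t + a t *\<^sub>R c t) + R"
      by (simp add: R_def sum.distrib)
    moreover have "(\<Sum>t=1..T. v t + a t *\<^sub>R c t) \<in> (*\<^sub>R) (real T) ` \<Psi>"
      using C sum_mem_scaled_motzkin [of Q C T v "\<lambda>t. a t *\<^sub>R c t"] T vQ moreau a(2)
      by (auto simp: convex_cone_scaleR less_imp_le)
    ultimately have "infdist (\<Sum>t=1..T. y t) ((*\<^sub>R) (real T) ` \<Psi>) \<le> norm R"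
      by (intro infdist_le2) (auto simp: dist_norm)
    also have "norm R \<le> 2 * max P (sqrt K) * sqrt (real m * real T)"
    proof -
      have inc: "incseq a"
        unfolding a_def by (intro monoI max.mono order_refl real_sqrt_le_mono mult_left_mono) auto
      \<comment> \<open>\<open>B\<close> stays free because the two cases insert different bounds on
        the iterates.\<close>
      have R: "norm R \<le> 2 * a T * B" if "\<And>t. t \<in> {1..Suc T} \<Longrightarrow> norm (p t) \<le> B" for B
        unfolding R_def using norm_sum_scaled_increments_le [of p a T B, OF p1 inc] that a(2) [of 0] by simp
      show ?thesis
      proof (cases "T \<le> m")
        case True
        have aT: "a t = real m" if "t \<le> T" for t
        proof -
          have "sqrt (real m * real t) \<le> real m"
            using True that by (intro real_le_lsqrt) (auto simp: power2_eq_square mult_left_mono)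
          then show ?thesis
            by (simp add: a_def)
        qed
        \<comment> \<open>The constant bound \<open>P\<close> would only give order \<open>m\<close>
          here; the growth bound supplies the missing factor \<open>sqrt (T / m)\<close>.\<close>
        have "norm (p t) \<le> sqrt (K * real T / real m)" if t: "t \<in> {1..Suc T}" for t
        proof -
          have "(\<Sum>s=1..<t. \<eta> s) = (\<Sum>s=1..<t. 1 / real m)"
            using \<eta>a aT t by (intro sum.cong) auto
          also have "\<dots> \<le> real T / real m"
            using t m by (simp add: divide_right_mono)
          finally have "K * (\<Sum>s=1..<t. \<eta> s) \<le> K * (real T / real m)"
            using \<open>K > 0\<close> by (intro mult_left_mono) auto
          with bounds(2) [OF t] show ?thesis
            by (intro real_le_rsqrt) simp
        qed
        then have "norm R \<le> 2 * (real m * sqrt (K * real T / real m))"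
          using R [of "sqrt (K * real T / real m)"] aT by (simp add: mult.assoc)
        also have "real m * sqrt (K * real T / real m) = sqrt K * sqrt (real m * real T)"
          using m by (simp add: real_sqrt_mult real_sqrt_divide field_simps)
        also have "\<dots> \<le> max P (sqrt K) * sqrt (real m * real T)"
          by (intro mult_right_mono) auto
        finally show ?thesis
          by simp
      next
        case False
        then have "sqrt (real m * real T) \<ge> real m"
          by (intro real_le_rsqrt) (simp add: power2_eq_square mult_left_mono)
        then have "norm R \<le> 2 * (P * sqrt (real m * real T))"
          using R [OF bounds(1)] by (simp add: a_def mult_ac)
        also have "P * sqrt (real m * real T) \<le> max P (sqrt K) * sqrt (real m * real T)"
          by (intro mult_right_mono) auto
        finally show ?thesis
          by simp
      qed
    qed
    finally show "infdist (\<Sum>t=1..T. y t) ((*\<^sub>R) (real T) ` \<Psi>)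
        \<le> 2 * max P (sqrt K) * sqrt (real m * real T)" .
  qed
qed

end
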